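(* Let $G$ and $H$ be graphs. Then $$\gamma_{cg}'(G[H]) = \begin{cases} \gamma_{cg}'(G); & \gamma_{cg}'(G) \geq 2,\\ 2; & \gamma_{cg}'(G) = 1,\ |V(G)| \geq 2 \text{ and } \gamma_{cg}'(H) \geq 2,\\ \gamma_{cg}'(H); & |V(G)| = 1, \text{ or } \big(\gamma_{cg}'(G) = 1,\ |V(G)| \geq 2 \text{ and } \gamma_{cg}'(H) = 1\big). \end{cases}$$
   Context: The connected domination game on a graph $G$ is played by two players, Dominator and Staller, who alternately select vertices. Each selected vertex must dominate at least one vertex not dominated by the previous moves (a vertex $w$ dominates the vertices of its closed neighborhood $N[w]$), and, except for the first move, it must be adjacent to at least one already selected vertex. The game ends when no more moves are possible, i.e. when the selected vertices form a connected dominating set. Dominator's goal is to finish the game with the smallest possible number of moves, while Staller aims to prolong the game. $\gamma_{cg}'(G)$ (the Staller-start connected game domination number) is the number of moves in the game on $G$ when Staller makes the first move and both players play optimally. The lexicographic product $G[H]$ has vertex set $V(G)\times V(H)$, with $(g_1,h_1)$ adjacent to $(g_2,h_2)$ if $g_1g_2\in E(G)$, or $g_1=g_2$ and $h_1h_2\in E(H)$. *)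

theory Defs
  imports "Graph_Theory.Graph_Theory"
begin

text \<open>
  Finite simple graphs are represented by the locale \<open>pair_graph\<close>: every edge is stored as
  two opposite arcs. The locale admits the empty graph, whereas \<open>connected\<close> excludes it.
\<close>

definition closed_nbhd :: "'a pair_pre_digraph \<Rightarrow> 'a \<Rightarrow> 'a set" where
  "closed_nbhd G v = insert v {w. (v, w) \<in> parcs G}"

definition dominated :: "'a pair_pre_digraph \<Rightarrow> 'a set \<Rightarrow> 'a set" where
  "dominated G S = (\<Union>v\<in>S. closed_nbhd G v)"

text \<open>
  A position of the connected domination game consists of the set \<open>S\<close> of vertices selected so
  far and the player to move; \<open>S = {}\<close> means that the first move is still to be made.
\<close>

definition legal_moves :: "'a pair_pre_digraph \<Rightarrow> 'a set \<Rightarrow> 'a set" where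
  "legal_moves G S =
     {v \<in> pverts G. \<not> closed_nbhd G v \<subseteq> dominated G S \<and>
        (S = {} \<or> (\<exists>u\<in>S. (u, v) \<in> parcs G))}"

lemma legal_moves_subset: "legal_moves G S \<subseteq> pverts G - S"
  by (auto simp: legal_moves_def dominated_def)

datatype player = Dominator | Staller

fun opponent :: "player \<Rightarrow> player" where
  "opponent Dominator = Staller"
| "opponent Staller = Dominator"

fun optimum :: "player \<Rightarrow> nat set \<Rightarrow> nat" where
  "optimum Dominator = Min"
| "optimum Staller = Max"

text \<open>
  The number of moves still to be made from a position under optimal play. The finiteness test
  only serves termination; the value for infinite graphs is irrelevant.
\<close>

function moves_left :: "'a pair_pre_digraph \<Rightarrow> player \<Rightarrow> 'a set \<Rightarrow> nat" where
  "moves_left G p S =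
     (if finite (pverts G) \<and> legal_moves G S \<noteq> {}
      then Suc (optimum p ((\<lambda>v. moves_left G (opponent p) (insert v S)) ` legal_moves G S))
      else 0)"
  by pat_completeness auto

termination
proof (relation "measure (\<lambda>(G, p, S). card (pverts G - S))", goal_cases)
  case 1
  show ?case by simp
next
  case (2 G p S v)
  then have "v \<in> pverts G - S"
    using legal_moves_subset[of G S] by auto
  then have "pverts G - insert v S \<subset> pverts G - S"
    by auto
  with 2 show ?case
    by (auto intro!: psubset_card_mono)
qed

declare moves_left.simps[simp del]

text \<open>
  The Staller-start connected game domination number. As in the literature it is meaningful only
  for connected graphs: on those, no legal move remains exactly when the selected vertices
  form a connected dominating set.
\<close>

definition staller_start_number :: "'a pair_pre_digraph \<Rightarrow> nat"  (\<open>\<gamma>''\<^sub>c\<^sub>g\<close>) where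
  "\<gamma>'\<^sub>c\<^sub>g G = moves_left G Staller {}"

definition lex_product ::
    "'a pair_pre_digraph \<Rightarrow> 'b pair_pre_digraph \<Rightarrow> ('a \<times> 'b) pair_pre_digraph" where
  "lex_product G H =
     \<lparr> pverts = pverts G \<times> pverts H,
       parcs = {((g1, h1), (g2, h2)).
         (g1, h1) \<in> pverts G \<times> pverts H \<and> (g2, h2) \<in> pverts G \<times> pverts H \<and>
         ((g1, g2) \<in> parcs G \<or> g1 = g2 \<and> (h1, h2) \<in> parcs H)} \<rparr>"

end

theory Submission
  imports Defs
begin

text \<open>
  Once vertices from two different layers of \<open>G[H]\<close> have been selected, every layer is dominated
  completely or not at all, so the game on \<open>G[H]\<close> coincides with the game on \<open>G\<close> played by the first
  coordinates. The two games can therefore differ only in Dominator's first reply: on \<open>G[H]\<close> he may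
  be able to make a move that amounts to passing on \<open>G\<close>. A continuation principle shows that
  passing never helps him: selecting further vertices, reachable from those already selected,
  cannot increase the number of moves still to be made. If no reply is possible on \<open>G\<close> after any
  first move, then \<open>G\<close> is complete and the game on \<open>G[H]\<close> lasts at most two moves, unless \<open>G\<close> has a
  single vertex.
\<close>

section \<open>Domination, legal moves and optimal play\<close>

lemma dominated_empty [simp]: "dominated G {} = {}"
  by (simp add: dominated_def)

lemma dominated_insert [simp]: "dominated G (insert v S) = closed_nbhd G v \<union> dominated G S"
  by (auto simp: dominated_def)

lemma closed_nbhd_self [simp]: "v \<in> closed_nbhd G v"
  by (simp add: closed_nbhd_def)

lemma subset_dominated: "S \<subseteq> dominated G S"
  by (auto simp: dominated_def)

lemma legal_moves_empty: "legal_moves G {} = pverts G"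
  by (auto simp: legal_moves_def closed_nbhd_def)

text \<open>After the first move, the legal moves depend only on the set of dominated vertices.\<close>

lemma legal_moves_iff:
  assumes "S \<noteq> {}"
  shows "v \<in> legal_moves G S \<longleftrightarrow>
    v \<in> pverts G \<and> v \<in> dominated G S \<and> \<not> closed_nbhd G v \<subseteq> dominated G S"
  using assms by (auto simp: legal_moves_def dominated_def closed_nbhd_def)

context
  fixes G :: "'a pair_pre_digraph"
  assumes fin: "finite (pverts G)"
begin

lemma finite_legal_moves: "finite (legal_moves G S)"
  using fin by (simp add: legal_moves_def)

lemma moves_left_eq_0_iff: "moves_left G p S = 0 \<longleftrightarrow> legal_moves G S = {}"
  using fin by (simp add: moves_left.simps[of G p S])

lemma moves_left_Suc:
  "legal_moves G S \<noteq> {} \<Longrightarrow> moves_left G p S =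
    Suc (optimum p ((\<lambda>v. moves_left G (opponent p) (insert v S)) ` legal_moves G S))"
  using fin by (simp add: moves_left.simps[of G p S])

lemma moves_left_attained:
  assumes "legal_moves G S \<noteq> {}"
  obtains v where "v \<in> legal_moves G S"
    and "moves_left G p S = Suc (moves_left G (opponent p) (insert v S))"
proof -
  let ?A = "(\<lambda>v. moves_left G (opponent p) (insert v S)) ` legal_moves G S"
  have "optimum p ?A \<in> ?A"
    using assms finite_legal_moves by (cases p) simp_all
  then show thesis
    using that moves_left_Suc[OF assms, of p] by auto
qed

lemma moves_left_Dominator_le:
  "v \<in> legal_moves G S \<Longrightarrow> moves_left G Dominator S \<le> Suc (moves_left G Staller (insert v S))"
  using finite_legal_moves by (subst moves_left_Suc) auto

lemma moves_left_Staller_ge: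
  "v \<in> legal_moves G S \<Longrightarrow> Suc (moves_left G Dominator (insert v S)) \<le> moves_left G Staller S"
  using finite_legal_moves by (subst moves_left_Suc) auto

end

section \<open>The continuation principle\<close>

text \<open>
  \<open>B\<close> dominates at least what \<open>A\<close> does, and every vertex of \<open>B\<close> is reached by starting from the
  vertices dominated by \<open>A\<close> and repeatedly selecting dominated vertices of \<open>B\<close>.
\<close>

definition extends :: "'a pair_pre_digraph \<Rightarrow> 'a set \<Rightarrow> 'a set \<Rightarrow> bool" where
  "extends G A B \<longleftrightarrow> dominated G A \<subseteq> dominated G B \<and>
     (\<forall>Z. dominated G A \<subseteq> Z \<longrightarrow> (\<forall>x\<in>B \<inter> Z. closed_nbhd G x \<subseteq> Z) \<longrightarrow> B \<subseteq> Z)"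

lemma extends_subset:
  assumes "extends G A B" "dominated G A \<subseteq> Z"
    and "\<And>x. x \<in> B \<Longrightarrow> x \<in> Z \<Longrightarrow> closed_nbhd G x \<subseteq> Z"
  shows "B \<subseteq> Z"
  using assms by (simp add: extends_def)

text \<open>Any closed \<open>Z\<close> that contains what \<open>A'\<close> dominates also contains
  what \<open>A\<close> dominates, hence \<open>B\<close>, hence everything \<open>B\<close>
  dominates, and \<open>v\<close> is among that.\<close>

lemma extends_step:
  assumes "extends G A B" "v \<in> dominated G B"
    and "dominated G A \<subseteq> dominated G A'" "dominated G A' \<subseteq> dominated G (insert v B)"
  shows "extends G A' (insert v B)"
  unfolding extends_def
proof (intro conjI allI impI)
  fix Z assume Z: "dominated G A' \<subseteq> Z" "\<forall>x\<in>insert v B \<inter> Z. closed_nbhd G x \<subseteq> Z"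
  then have "B \<subseteq> Z"
    using assms(3) by (intro extends_subset[OF assms(1)]) auto
  moreover have "dominated G B \<subseteq> Z"
    using \<open>B \<subseteq> Z\<close> Z(2) by (auto simp: dominated_def)
  ultimately show "insert v B \<subseteq> Z"
    using assms(2) by blast
qed (fact assms(4))

text \<open>If \<open>A\<close> does not dominate \<open>v\<close>, some vertex of \<open>B\<close>
  can be selected on \<open>A\<close> with a new vertex dominated: otherwise the reachability
  condition would put \<open>B\<close>, and then all that it dominates, including \<open>v\<close>,
  inside what \<open>A\<close> dominates.\<close>

lemma extends_legal_move:
  assumes "extends G A B" "A \<noteq> {}" "B \<noteq> {}" "B \<subseteq> pverts G" "v \<in> legal_moves G B"
  obtains x where "x \<in> legal_moves G A" "closed_nbhd G x \<subseteq> dominated G (insert v B)"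
proof (cases "v \<in> dominated G A")
  case True
  then have "v \<in> legal_moves G A"
    using assms by (auto simp: legal_moves_iff extends_def)
  then show thesis
    using that by simp
next
  case False
  have "\<exists>x\<in>B \<inter> dominated G A. \<not> closed_nbhd G x \<subseteq> dominated G A"
  proof (rule ccontr)
    assume "\<not> ?thesis"
    then have *: "\<forall>x\<in>B \<inter> dominated G A. closed_nbhd G x \<subseteq> dominated G A"
      by blast
    then have "B \<subseteq> dominated G A"
      by (intro extends_subset[OF assms(1)]) auto
    with * have "dominated G B \<subseteq> dominated G A"
      unfolding dominated_def[of G B] by blast
    then show False
      using False assms by (auto simp: legal_moves_iff)
  qed
  then obtain x where "x \<in> B" "x \<in> dominated G A" "\<not> closed_nbhd G x \<subseteq> dominated G A"
    by blast
  moreover have "closed_nbhd G x \<subseteq> dominated G (insert v B)"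
    using \<open>x \<in> B\<close> by (auto simp: dominated_def)
  ultimately show thesis
    using that assms(2,4) by (auto simp: legal_moves_iff)
qed

text \<open>
  Dominator plays on \<open>B\<close> as he would on \<open>A\<close>. A Staller move on \<open>B\<close> that is not available on \<open>A\<close>
  is imagined as the selection of a vertex of \<open>B\<close> on \<open>A\<close>; if Dominator's own move on \<open>A\<close> achieves
  nothing on \<open>B\<close>, he plays any legal move instead.
\<close>

lemma moves_left_extends:
  assumes "finite (pverts G)" "extends G A B" "A \<noteq> {}" "B \<noteq> {}" "B \<subseteq> pverts G"
  shows "moves_left G p B \<le> moves_left G p A"
  using assms
proof (induction G p B arbitrary: A rule: moves_left.induct)
  case (1 G p B)
  note prems = "1.prems"
  show ?case
  proof (cases "legal_moves G B = {}")
    case True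
    then show ?thesis
      using moves_left_eq_0_iff[OF prems(1)] by (metis le0)
  next
    case False
    have step: "moves_left G (opponent p) (insert w B) \<le> moves_left G (opponent p) (insert u A)"
      if w: "w \<in> legal_moves G B" and u: "closed_nbhd G u \<subseteq> dominated G (insert w B)" for w u
    proof (rule "1.IH")
      show "extends G (insert u A) (insert w B)"
        using w u prems by (intro extends_step[of G A]) (auto simp: legal_moves_iff extends_def)
      show "insert w B \<subseteq> pverts G"
        using w prems by (auto simp: legal_moves_iff)
    qed (use w prems False in auto)
    obtain v0 where "v0 \<in> legal_moves G B"
      using False by blast
    then obtain x0 where "x0 \<in> legal_moves G A"
      using extends_legal_move prems by metis
    then have A: "legal_moves G A \<noteq> {}"
      by blast
    show ?thesis
    proof (cases p)
      case Dominator
      obtain u where u: "u \<in> legal_moves G A"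
        and eq: "moves_left G Dominator A = Suc (moves_left G Staller (insert u A))"
        using moves_left_attained[OF prems(1) A, of Dominator] by auto
      have "\<exists>w\<in>legal_moves G B. closed_nbhd G u \<subseteq> dominated G (insert w B)"
      proof (cases "u \<in> legal_moves G B")
        case False
        then have "closed_nbhd G u \<subseteq> dominated G B"
          using u prems by (auto simp: legal_moves_iff extends_def)
        then show ?thesis
          using \<open>v0 \<in> legal_moves G B\<close> by auto
      qed auto
      then obtain w where w: "w \<in> legal_moves G B" "closed_nbhd G u \<subseteq> dominated G (insert w B)"
        by blast
      show ?thesis
        using moves_left_Dominator_le[OF prems(1) w(1)] step[OF w] eq Dominator by simp
    next
      case Staller
      obtain v where v: "v \<in> legal_moves G B"
        and eq: "moves_left G Staller B = Suc (moves_left G Dominator (insert v B))"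
        using moves_left_attained[OF prems(1) False, of Staller] by auto
      obtain x where x: "x \<in> legal_moves G A" "closed_nbhd G x \<subseteq> dominated G (insert v B)"
        using extends_legal_move[OF prems(2-5) v] .
      show ?thesis
        using moves_left_Staller_ge[OF prems(1) x(1)] step[OF v x(2)] eq Staller by simp
    qed
  qed
qed

text \<open>Every set lies in what it dominates, so two sets that dominate the same vertices extend
  each other, and the continuation principle applies both ways.\<close>

lemma moves_left_dominated_cong:
  assumes "finite (pverts G)" "A \<noteq> {}" "B \<noteq> {}" "A \<subseteq> pverts G" "B \<subseteq> pverts G"
    and "dominated G A = dominated G B"
  shows "moves_left G p A = moves_left G p B"
proof (rule antisym)
  have "extends G B A" "extends G A B"
    using assms(6) subset_dominated[of A G] subset_dominated[of B G]
    by (auto simp: extends_def)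
  then show "moves_left G p A \<le> moves_left G p B" "moves_left G p B \<le> moves_left G p A"
    using assms by (auto intro: moves_left_extends)
qed

lemma moves_left_insert_le:
  assumes "finite (pverts G)" "S \<noteq> {}" "S \<subseteq> pverts G" "v \<in> pverts G" "v \<in> dominated G S"
  shows "moves_left G p (insert v S) \<le> moves_left G p S"
proof (rule moves_left_extends)
  show "extends G S (insert v S)"
    using assms(5) subset_dominated[of S G] by (auto simp: extends_def)
qed (use assms in auto)

text \<open>Any legal move of Dominator is at least as good as a pass, because the extra vertex
  cannot prolong the game.\<close>

lemma moves_left_Dominator_le_pass:
  assumes "finite (pverts G)" "S \<noteq> {}" "S \<subseteq> pverts G"
  shows "moves_left G Dominator S \<le> Suc (moves_left G Staller S)"
proof (cases "legal_moves G S = {}")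
  case True
  then show ?thesis
    using moves_left_eq_0_iff[OF assms(1)] by (metis le0)
next
  case False
  then obtain v where v: "v \<in> legal_moves G S"
    by blast
  then have "moves_left G Staller (insert v S) \<le> moves_left G Staller S"
    using assms by (intro moves_left_insert_le) (auto simp: legal_moves_iff)
  then show ?thesis
    using moves_left_Dominator_le[OF assms(1) v] by simp
qed

section \<open>Transferring the game along a map\<close>

text \<open>\<open>f\<close> need not be injective: \<open>Min\<close> and \<open>Max\<close> see
  only the set of values of the options, so options with the same image may be merged. The invariant
  \<open>I\<close> confines the comparison to positions where the legal moves correspond.\<close>

lemma moves_left_image:
  assumes "finite (pverts K)" "finite (pverts G)"
    and legal: "\<And>S. I S \<Longrightarrow> legal_moves G (f ` S) = f ` legal_moves K S"
    and invar: "\<And>S v. I S \<Longrightarrow> v \<in> legal_moves K S \<Longrightarrow> I (insert v S)"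
    and "I S"
  shows "moves_left K p S = moves_left G p (f ` S)"
  using assms(1,5)
proof (induction "card (pverts K - S)" arbitrary: p S rule: less_induct)
  case less
  show ?case
  proof (cases "legal_moves K S = {}")
    case True
    then show ?thesis
      using less.prems assms(2) legal[of S] by (simp add: moves_left.simps)
  next
    case False
    have IH: "moves_left K (opponent p) (insert v S) = moves_left G (opponent p) (insert (f v) (f ` S))"
      if v: "v \<in> legal_moves K S" for v
    proof -
      have "card (pverts K - insert v S) < card (pverts K - S)"
        using v legal_moves_subset[of K S] less.prems by (intro psubset_card_mono) auto
      then show ?thesis
        using less.hyps[of "insert v S"] less.prems invar v by simp
    qed
    have "(\<lambda>v. moves_left K (opponent p) (insert v S)) ` legal_moves K S =
          (\<lambda>v. moves_left G (opponent p) (insert v (f ` S))) ` legal_moves G (f ` S)"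
      unfolding legal[OF less.prems(2)] image_image using IH by (intro image_cong) auto
    then show ?thesis
      using False legal[OF less.prems(2)] less.prems assms(2)
      by (simp add: moves_left_Suc)
  qed
qed

section \<open>Connected graphs and Staller's first move\<close>

context pair_graph
begin

text \<open>Symmetric arcs make connectedness strong, so every vertex is reachable from
  \<open>D\<close>, along arcs that never leave \<open>D\<close>.\<close>

lemma connected_imp_closed_eq:
  assumes "connected (with_proj G)" "D \<noteq> {}" "D \<subseteq> pverts G"
    and closed: "\<And>v. v \<in> D \<Longrightarrow> closed_nbhd G v \<subseteq> D"
  shows "D = pverts G"
proof -
  obtain u where u: "u \<in> D"
    using assms(2) by blast
  have "v \<in> D" if "v \<in> pverts G" for v
  proof -
    have "symmetric (with_proj G)"
      using pair_sym_arcs .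
    then have "u \<rightarrow>\<^sup>*\<^bsub>with_proj G\<^esub> v"
      using symmetric_connected_imp_strongly_connected[OF _ assms(1)] u that assms(3)
      by (auto simp: strongly_connected_def)
    then show ?thesis
      by (induction rule: reachable_induct) (use u closed in \<open>auto simp: closed_nbhd_def\<close>)
  qed
  with assms(3) show ?thesis
    by blast
qed

lemma dominated_subset: "S \<subseteq> pverts G \<Longrightarrow> dominated G S \<subseteq> pverts G"
  by (auto simp: dominated_def closed_nbhd_def dest: in_arcsD2)

text \<open>Without legal moves, the closed neighborhood of every dominated vertex is dominated, so
  the dominated set is closed under adjacency.\<close>

lemma connected_imp_dominated_eq:
  assumes "connected (with_proj G)" "S \<noteq> {}" "S \<subseteq> pverts G" "legal_moves G S = {}"
  shows "dominated G S = pverts G"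
proof (rule connected_imp_closed_eq)
  show "closed_nbhd G v \<subseteq> dominated G S" if "v \<in> dominated G S" for v
    using that assms dominated_subset[of S] legal_moves_iff[of S v G] by auto
qed (use assms subset_dominated[of S G] dominated_subset in auto)

lemma connected_imp_neighbor:
  assumes "connected (with_proj G)" "g \<in> pverts G" "pverts G \<noteq> {g}"
  obtains v where "(g, v) \<in> parcs G"
proof -
  have "\<exists>v. (g, v) \<in> parcs G"
  proof (rule ccontr)
    assume "\<not> ?thesis"
    then have "{g} = pverts G"
      using assms by (intro connected_imp_closed_eq) (auto simp: closed_nbhd_def)
    with assms(3) show False
      by simp
  qed
  with that show thesis
    by blast
qed

lemma staller_start_number_ge:
  "v \<in> pverts G \<Longrightarrow> Suc (moves_left G Dominator {v}) \<le> \<gamma>'\<^sub>c\<^sub>g G"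
  using moves_left_Staller_ge[OF pair_finite_verts, of v "{}"]
  by (simp add: staller_start_number_def legal_moves_empty)

lemma staller_start_number_attained:
  assumes "pverts G \<noteq> {}"
  obtains v where "v \<in> pverts G" "\<gamma>'\<^sub>c\<^sub>g G = Suc (moves_left G Dominator {v})"
  using moves_left_attained[OF pair_finite_verts, of "{}" Staller] assms
  by (auto simp: staller_start_number_def legal_moves_empty)

text \<open>Staller maximizes over all first moves, so the value 1 bounds each of them.\<close>

lemma staller_start_number_eq_1D:
  assumes "\<gamma>'\<^sub>c\<^sub>g G = 1" "v \<in> pverts G"
  shows "legal_moves G {v} = {}"
  using staller_start_number_ge[OF assms(2)] assms(1)
    moves_left_eq_0_iff[OF pair_finite_verts, of Dominator "{v}"] by simp

end

section \<open>The lexicographic product\<close>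

locale lex_pair = G: pair_graph G + H: pair_graph H
  for G :: "'a pair_pre_digraph" and H :: "'b pair_pre_digraph"
begin

abbreviation K :: "('a \<times> 'b) pair_pre_digraph" where
  "K \<equiv> lex_product G H"

lemma pverts_K [simp]: "pverts K = pverts G \<times> pverts H"
  by (simp add: lex_product_def)

lemma parcs_K:
  "((g1, h1), (g2, h2)) \<in> parcs K \<longleftrightarrow>
    h1 \<in> pverts H \<and> h2 \<in> pverts H \<and>
    ((g1, g2) \<in> parcs G \<or> g1 \<in> pverts G \<and> g1 = g2 \<and> (h1, h2) \<in> parcs H)"
  by (auto simp: lex_product_def dest: G.in_arcsD1 G.in_arcsD2)

lemma finite_K: "finite (pverts K)"
  using G.pair_finite_verts H.pair_finite_verts by simp

lemma pair_graph_K: "pair_graph K"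
proof
  show "finite (parcs K)"
    by (rule finite_subset[OF _ finite_cartesian_product[OF finite_K finite_K]])
      (auto simp: lex_product_def)
  show "symmetric (with_proj K)"
    unfolding symmetric_def with_proj_simps
    by (rule symI) (auto simp: lex_product_def intro: G.arcs_symmetric H.arcs_symmetric)
  show "fst e \<noteq> snd e" if "e \<in> parcs K" for e
    using that G.no_loops' H.no_loops' by (cases e) (auto simp: lex_product_def)
qed (use finite_K in \<open>simp_all add: lex_product_def split: prod.splits\<close>)

sublocale K: pair_graph K
  by (rule pair_graph_K)

lemma closed_nbhd_K:
  assumes "g \<in> pverts G" "h \<in> pverts H"
  shows "closed_nbhd K (g, h) = {a. (g, a) \<in> parcs G} \<times> pverts H \<union> {g} \<times> closed_nbhd H h"
  using assms by (auto simp: closed_nbhd_def parcs_K dest: H.in_arcsD2)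

lemma dominated_K_subset:
  assumes "S \<subseteq> pverts K"
  shows "dominated K S \<subseteq> dominated G (fst ` S) \<times> pverts H"
proof
  fix x assume "x \<in> dominated K S"
  then obtain g h where gh: "(g, h) \<in> S" "x \<in> closed_nbhd K (g, h)"
    by (auto simp: dominated_def)
  then have verts: "g \<in> pverts G" "h \<in> pverts H"
    using assms by auto
  with gh(2) have "x \<in> closed_nbhd G g \<times> pverts H"
    unfolding closed_nbhd_K[OF verts] by (auto simp: closed_nbhd_def dest: H.in_arcsD2)
  moreover have "closed_nbhd G g \<subseteq> dominated G (fst ` S)"
    using imageI[OF gh(1), of fst] by (auto simp: dominated_def)
  ultimately show "x \<in> dominated G (fst ` S) \<times> pverts H"
    by auto
qed

section \<open>Positions spread over adjacent layers\<close>

text \<open>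
  Once every layer that contains a selected vertex is adjacent to another such layer, all layers
  are dominated completely or not at all.
\<close>

definition spread :: "('a \<times> 'b) set \<Rightarrow> bool" where
  "spread S \<longleftrightarrow> S \<noteq> {} \<and> S \<subseteq> pverts K \<and> (\<forall>v\<in>fst ` S. \<exists>u\<in>fst ` S. (u, v) \<in> parcs G)"

text \<open>A selected vertex dominates every adjacent layer completely. A layer containing a
  selected vertex is itself adjacent to another such layer, so it is covered too.\<close>

lemma dominated_spread:
  assumes "spread S"
  shows "dominated K S = dominated G (fst ` S) \<times> pverts H"
proof
  show "dominated K S \<subseteq> dominated G (fst ` S) \<times> pverts H"
    using assms by (intro dominated_K_subset) (simp add: spread_def)
  show "dominated G (fst ` S) \<times> pverts H \<subseteq> dominated K S"
  proof clarify
    fix a b assume "a \<in> dominated G (fst ` S)" "b \<in> pverts H"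
    then obtain u where "u \<in> fst ` S" "(u, a) \<in> parcs G"
      using assms unfolding dominated_def closed_nbhd_def spread_def by blast
    then obtain h where "(u, h) \<in> S" "(u, a) \<in> parcs G"
      by auto
    moreover from this have "u \<in> pverts G" "h \<in> pverts H"
      using assms by (auto simp: spread_def)
    ultimately show "(a, b) \<in> dominated K S"
      using \<open>b \<in> pverts H\<close> unfolding dominated_def by (intro UN_I) (auto simp: closed_nbhd_K)
  qed
qed

lemma legal_moves_spread:
  assumes "spread S"
  shows "legal_moves K S = legal_moves G (fst ` S) \<times> pverts H"
proof -
  have ne: "S \<noteq> {}" "fst ` S \<noteq> {}"
    using assms by (auto simp: spread_def)
  have "closed_nbhd K (a, b) \<subseteq> dominated K S \<longleftrightarrow> closed_nbhd G a \<subseteq> dominated G (fst ` S)"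
    if "a \<in> dominated G (fst ` S)" "a \<in> pverts G" "b \<in> pverts H" for a b
    unfolding closed_nbhd_K[OF that(2,3)] dominated_spread[OF assms]
    using that by (auto simp: closed_nbhd_def dest: H.in_arcsD2)
  then have "(a, b) \<in> legal_moves K S \<longleftrightarrow>
      (a, b) \<in> legal_moves G (fst ` S) \<times> pverts H" for a b
    unfolding legal_moves_iff[OF ne(1)] mem_Sigma_iff legal_moves_iff[OF ne(2)]
    by (auto simp: dominated_spread[OF assms])
  then show ?thesis
    by auto
qed

text \<open>The game is transferred along \<open>fst\<close>. The invariant \<open>spread\<close>
  survives because a legal move of \<open>G\<close> is adjacent to a selected vertex, so the new
  layer has a neighboring selected layer.\<close>

lemma moves_left_spread:
  assumes "spread S"
  shows "moves_left K p S = moves_left G p (fst ` S)"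
proof (rule moves_left_image[OF finite_K G.pair_finite_verts, where I = spread])
  show "legal_moves G (fst ` T) = fst ` legal_moves K T" if "spread T" for T
    using that legal_moves_spread[OF that] by (auto simp: spread_def)
  show "spread (insert v T)" if T: "spread T" and v: "v \<in> legal_moves K T" for T v
  proof -
    have "v \<in> pverts K" "fst v \<in> legal_moves G (fst ` T)"
      using v legal_moves_spread[OF T] legal_moves_subset[of K T] by (auto simp del: pverts_K)
    then have "\<exists>u\<in>fst ` T. (u, fst v) \<in> parcs G"
      using T by (auto simp: legal_moves_def spread_def)
    then show ?thesis
      using T \<open>v \<in> pverts K\<close> unfolding spread_def by auto
  qed
qed fact

lemma moves_left_two_layers:
  assumes "S \<subseteq> pverts K" "fst ` S = {g}" "(g, v) \<in> parcs G" "h \<in> pverts H"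
  shows "moves_left K p (insert (v, h) S) = moves_left G p {v, g}"
proof -
  have "spread (insert (v, h) S)"
    using assms G.in_arcsD2[OF assms(3)] G.arcs_symmetric[OF assms(3)]
    by (auto simp: spread_def)
  from moves_left_spread[OF this] assms(2) show ?thesis
    by simp
qed

text \<open>What is dominated in \<open>K\<close> projects into what is dominated in
  \<open>G\<close>, so a vertex \<open>y\<close> newly dominated by \<open>v\<close> yields the
  undominated vertex \<open>(y, h)\<close>.\<close>

lemma legal_moves_one_layer:
  assumes "S \<subseteq> pverts K" "fst ` S = {g}" "v \<in> legal_moves G {g}" "h \<in> pverts H"
  shows "(v, h) \<in> legal_moves K S" "(g, v) \<in> parcs G"
proof -
  show adj: "(g, v) \<in> parcs G"
    using assms(3) by (auto simp: legal_moves_def)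
  have v: "v \<in> pverts G" and new: "\<not> closed_nbhd G v \<subseteq> dominated G {g}"
    using assms(3) by (auto simp: legal_moves_def)
  from new obtain y where y: "y \<in> closed_nbhd G v" "y \<notin> dominated G {g}"
    by blast
  have "(y, h) \<in> closed_nbhd K (v, h)"
    using y(1) v assms(4) by (auto simp: closed_nbhd_K closed_nbhd_def[of G])
  moreover have "(y, h) \<notin> dominated K S"
    using dominated_K_subset[OF assms(1)] y(2) assms(2) by auto
  moreover obtain h' where "(g, h') \<in> S"
    using assms(2) by (metis imageE insertI1 prod.collapse)
  moreover from this have "((g, h'), (v, h)) \<in> parcs K"
    using adj assms(1,4) by (auto simp: parcs_K)
  ultimately show "(v, h) \<in> legal_moves K S"
    using v assms(4) by (auto simp: legal_moves_def)
qed

section \<open>Dominator's reply to the first move\<close>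

text \<open>Dominator copies his optimal reply from \<open>G\<close>. If \<open>G\<close> offers
  none while \<open>K\<close> still does, he moves to an adjacent layer, which ends the game; this
  single move accounts for the 1 in the maximum.\<close>

lemma moves_left_first_move_le:
  assumes "(g, v) \<in> parcs G" "h \<in> pverts H"
  shows "moves_left K Dominator {(g, h)} \<le> max 1 (moves_left G Dominator {g})"
proof (cases "legal_moves K {(g, h)} = {}")
  case True
  then show ?thesis
    using moves_left_eq_0_iff[OF finite_K, of Dominator "{(g, h)}"] by simp
next
  case nonempty: False
  have g: "g \<in> pverts G"
    using G.in_arcsD1[OF assms(1)] .
  have first: "{(g, h)} \<subseteq> pverts K" "fst ` {(g, h)} = {g}"
    using g assms(2) by auto
  show ?thesis
  proof (cases "legal_moves G {g} = {}")
    case False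
    obtain u where u: "u \<in> legal_moves G {g}"
      and eq: "moves_left G Dominator {g} = Suc (moves_left G Staller {u, g})"
      using moves_left_attained[OF G.pair_finite_verts False, of Dominator] by auto
    have legal: "(u, h) \<in> legal_moves K {(g, h)}" and adj: "(g, u) \<in> parcs G"
      using legal_moves_one_layer[OF first u assms(2)] .
    show ?thesis
      using moves_left_Dominator_le[OF finite_K legal] eq
        moves_left_two_layers[OF first adj assms(2)] by simp
  next
    case True
    obtain a b where ab: "(a, b) \<in> legal_moves K {(g, h)}"
      using nonempty by auto
    \<comment> \<open>Dominator needs a legal move outside the layer of \<open>g\<close>. If the
      given move stays inside, it reveals an undominated vertex of that layer, which the neighboring
      \<open>(v, h)\<close> dominates.\<close>
    obtain u k where u: "(u, k) \<in> legal_moves K {(g, h)}" "(g, u) \<in> parcs G"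
    proof (cases "(g, a) \<in> parcs G")
      case True
      then show thesis
        using that ab by blast
    next
      case False
      then have "a = g" "(h, b) \<in> parcs H"
        using ab by (auto simp: legal_moves_def parcs_K)
      then obtain y where y: "y \<in> pverts H" "y \<notin> closed_nbhd H h"
        using ab g assms(2) closed_nbhd_K[of g h] closed_nbhd_K[of g b]
        by (auto simp: legal_moves_def closed_nbhd_def[of H] dest: H.in_arcsD2)
      have "(g, y) \<in> closed_nbhd K (v, h)"
        using y(1) assms G.in_arcsD2 G.arcs_symmetric by (auto simp: closed_nbhd_K)
      moreover have "(g, y) \<notin> dominated K {(g, h)}"
        using y(2) g assms(2) G.no_loops' by (auto simp: closed_nbhd_K)
      ultimately have "(v, h) \<in> legal_moves K {(g, h)}"
        using assms G.in_arcsD2 by (auto simp: legal_moves_def parcs_K)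
      then show thesis
        using that assms(1) by blast
    qed
    have k: "k \<in> pverts H"
      using u(1) by (auto simp: legal_moves_def)
    \<comment> \<open>The game on \<open>G\<close> is over after \<open>g\<close>, and selecting
      \<open>u\<close> as well cannot revive it.\<close>
    have "moves_left G Staller {u, g} \<le> moves_left G Staller {g}"
      using u(2) g G.in_arcsD2 G.pair_finite_verts
      by (intro moves_left_insert_le) (auto simp: closed_nbhd_def)
    also have "\<dots> = 0"
      using True by (simp add: moves_left_eq_0_iff[OF G.pair_finite_verts])
    finally show ?thesis
      using moves_left_Dominator_le[OF finite_K u(1)]
        moves_left_two_layers[OF first u(2) k, of Staller] by simp
  qed
qed

text \<open>
  Besides the moves of the game on \<open>G\<close>, Dominator can waste his reply to the first move, inside the
  layer of \<open>g\<close> or in a layer whose projection dominates nothing new. This amounts to passing in \<open>G\<close>.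
\<close>

lemma moves_left_first_move_ge:
  assumes g: "g \<in> pverts G" and h: "h \<in> pverts H"
  shows "moves_left G Dominator {g} \<le> moves_left K Dominator {(g, h)}"
proof (cases "legal_moves G {g} = {}")
  case True
  then show ?thesis
    using moves_left_eq_0_iff[OF G.pair_finite_verts, of Dominator "{g}"] by simp
next
  case False
  have first: "{(g, h)} \<subseteq> pverts K" "fst ` {(g, h)} = {g}"
    using g h by auto
  have "legal_moves K {(g, h)} \<noteq> {}"
    using legal_moves_one_layer(1)[OF first _ h] False by blast
  then obtain x where x: "x \<in> legal_moves K {(g, h)}"
    and eq: "moves_left K Dominator {(g, h)} = Suc (moves_left K Staller (insert x {(g, h)}))"
    using moves_left_attained[OF finite_K, of _ Dominator] by (metis opponent.simps(1))
  obtain a b where ab: "x = (a, b)" "b \<in> pverts H" "a \<in> pverts G"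
    using x by (cases x) (auto simp: legal_moves_def)
  have pass: "moves_left G Dominator {g} \<le> Suc (moves_left G Staller {g})"
    using g by (intro moves_left_Dominator_le_pass G.pair_finite_verts) auto
  show ?thesis
  proof (cases "(g, a) \<in> parcs G")
    case True
    have "moves_left G Dominator {g} \<le> Suc (moves_left G Staller {a, g})"
    proof (cases "a \<in> legal_moves G {g}")
      case True
      then show ?thesis
        using moves_left_Dominator_le[OF G.pair_finite_verts True] by simp
    next
      case False
      then have "closed_nbhd G a \<subseteq> dominated G {g}"
        using True ab by (auto simp: legal_moves_def)
      then have "moves_left G Staller {a, g} = moves_left G Staller {g}"
        using ab(3) g G.pair_finite_verts by (intro moves_left_dominated_cong) auto
      with pass show ?thesis
        by simp
    qed
    then show ?thesis
      using eq moves_left_two_layers[OF first True ab(2), of Staller] ab(1) by simp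
  next
    case not_adj: False
    then have a: "a = g"
      using x ab(1) by (auto simp: legal_moves_def parcs_K)
    let ?T = "{(g, b), (g, h)}"
    have T: "?T \<subseteq> pverts K" "fst ` ?T = {g}"
      using g h ab(2) by auto
    \<comment> \<open>Staller answers the wasted move with her optimal move on \<open>G\<close>,
      which leaves the layer of \<open>g\<close>; from then on both games agree.\<close>
    obtain v where v: "v \<in> legal_moves G {g}"
      and eqv: "moves_left G Staller {g} = Suc (moves_left G Dominator {v, g})"
      using moves_left_attained[OF G.pair_finite_verts False, of Staller] by auto
    note l = legal_moves_one_layer[OF T v h]
    have "moves_left G Staller {g} \<le> moves_left K Staller ?T"
      using moves_left_Staller_ge[OF finite_K l(1)] moves_left_two_layers[OF T l(2) h] eqv by simp
    with pass eq show ?thesis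
      by (simp add: ab(1) a)
  qed
qed

section \<open>The case of a single vertex in the first factor\<close>

text \<open>Without loops \<open>G\<close> has no arcs, so \<open>K\<close> is a copy of
  \<open>H\<close> and \<open>snd\<close> transfers the game.\<close>

lemma moves_left_single_layer:
  assumes "pverts G = {g}" "S \<subseteq> pverts K"
  shows "moves_left K p S = moves_left H p (snd ` S)"
proof (rule moves_left_image[OF finite_K H.pair_finite_verts, where I = "\<lambda>S. S \<subseteq> pverts K"])
  have no_arcs: "parcs G = {}"
  proof (rule ccontr)
    assume "parcs G \<noteq> {}"
    then obtain a b where ab: "(a, b) \<in> parcs G"
      by fast
    then have "a = g" "b = g"
      using G.in_arcsD1[OF ab] G.in_arcsD2[OF ab] assms(1) by simp_all
    then show False
      using G.no_loops'[OF ab] by simp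
  qed
  show "legal_moves H (snd ` T) = snd ` legal_moves K T" if T: "T \<subseteq> pverts K" for T
  proof -
    have nbhd: "closed_nbhd K (g, h) = {g} \<times> closed_nbhd H h" if "h \<in> pverts H" for h
      using closed_nbhd_K[of g h] that assms(1) no_arcs by simp
    have T': "T = {g} \<times> snd ` T"
      using T assms(1) by force
    have dom: "dominated K T = {g} \<times> dominated H (snd ` T)"
    proof -
      have "dominated K T = (\<Union>h\<in>snd ` T. closed_nbhd K (g, h))"
        unfolding dominated_def by (subst T') auto
      also have "\<dots> = (\<Union>h\<in>snd ` T. {g} \<times> closed_nbhd H h)"
        using T nbhd by (intro SUP_cong) auto
      finally show ?thesis
        by (auto simp: dominated_def)
    qed
    have "legal_moves K T = {g} \<times> legal_moves H (snd ` T)"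
    proof (cases "T = {}")
      case True
      then show ?thesis
        by (simp add: legal_moves_empty assms(1))
    next
      case False
      then have "x \<in> legal_moves K T \<longleftrightarrow> x \<in> {g} \<times> legal_moves H (snd ` T)" for x
        by (cases x) (auto simp: legal_moves_iff dom nbhd assms(1) times_subset_iff)
      then show ?thesis
        by blast
    qed
    then show ?thesis
      by simp
  qed
qed (use assms(2) in \<open>auto simp: legal_moves_def\<close>)

lemma staller_start_number_single_layer:
  assumes "pverts G = {g}"
  shows "\<gamma>'\<^sub>c\<^sub>g K = \<gamma>'\<^sub>c\<^sub>g H"
  using moves_left_single_layer[OF assms, of "{}"] by (simp add: staller_start_number_def)

section \<open>Connected first factor with at least two vertices\<close>

context
  assumes conn: "connected (with_proj G)" and nontrivial: "\<And>g. pverts G \<noteq> {g}"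
    and H_nonempty: "pverts H \<noteq> {}"
begin

lemma G_nonempty: "pverts G \<noteq> {}"
  using conn by (auto simp: connected_conv)

text \<open>Staller starts in the layer of an optimal first vertex of \<open>G\<close>.\<close>

lemma staller_start_number_ge_left: "\<gamma>'\<^sub>c\<^sub>g G \<le> \<gamma>'\<^sub>c\<^sub>g K"
proof -
  obtain g where g: "g \<in> pverts G" "\<gamma>'\<^sub>c\<^sub>g G = Suc (moves_left G Dominator {g})"
    using G.staller_start_number_attained[OF G_nonempty] .
  obtain h where h: "h \<in> pverts H"
    using H_nonempty by blast
  show ?thesis
    using moves_left_first_move_ge[OF g(1) h] K.staller_start_number_ge[of "(g, h)"] g h by simp
qed

text \<open>The 2 counts the first move and the single reply that may be needed when the game on
  \<open>G\<close> is already over.\<close>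

lemma staller_start_number_le_max: "\<gamma>'\<^sub>c\<^sub>g K \<le> max 2 (\<gamma>'\<^sub>c\<^sub>g G)"
proof -
  have ne: "pverts K \<noteq> {}"
    using G_nonempty H_nonempty by simp
  obtain x where x: "x \<in> pverts K" "\<gamma>'\<^sub>c\<^sub>g K = Suc (moves_left K Dominator {x})"
    using K.staller_start_number_attained[OF ne] .
  then obtain g h where gh: "x = (g, h)" "g \<in> pverts G" "h \<in> pverts H"
    by auto
  obtain v where "(g, v) \<in> parcs G"
    using G.connected_imp_neighbor[OF conn gh(2) nontrivial] .
  from moves_left_first_move_le[OF this gh(3)] show ?thesis
    using x(2) gh(1) G.staller_start_number_ge[OF gh(2)] by simp
qed

text \<open>If Staller starts at an optimal vertex \<open>h\<close> of \<open>H\<close> in any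
  layer, some reply \<open>b\<close> in \<open>H\<close> remains legal inside that layer, so a
  second move exists.\<close>

lemma staller_start_number_complete:
  assumes "\<gamma>'\<^sub>c\<^sub>g G = 1" "\<gamma>'\<^sub>c\<^sub>g H \<ge> 2"
  shows "\<gamma>'\<^sub>c\<^sub>g K = 2"
proof -
  obtain h where h: "h \<in> pverts H" "\<gamma>'\<^sub>c\<^sub>g H = Suc (moves_left H Dominator {h})"
    using H.staller_start_number_attained[OF H_nonempty] .
  then have "legal_moves H {h} \<noteq> {}"
    using assms(2) moves_left_eq_0_iff[OF H.pair_finite_verts, of Dominator "{h}"] by auto
  then obtain b where b: "b \<in> legal_moves H {h}"
    by blast
  obtain g where g: "g \<in> pverts G"
    using G_nonempty by blast
  have "(g, b) \<in> legal_moves K {(g, h)}"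
    using b g h(1) G.no_loops'[of g g] closed_nbhd_K[of g h] closed_nbhd_K[of g b]
    by (auto simp: legal_moves_def parcs_K)
  then have "moves_left K Dominator {(g, h)} \<noteq> 0"
    using moves_left_eq_0_iff[OF finite_K] by auto
  then show ?thesis
    using K.staller_start_number_ge[of "(g, h)"] g h(1) staller_start_number_le_max assms(1) by simp
qed

text \<open>In both connected factors any single vertex dominates everything, and this carries over
  to \<open>K\<close>.\<close>

lemma staller_start_number_complete_complete:
  assumes "\<gamma>'\<^sub>c\<^sub>g G = 1" "\<gamma>'\<^sub>c\<^sub>g H = 1" "connected (with_proj H)"
  shows "\<gamma>'\<^sub>c\<^sub>g K = 1"
proof -
  have ne: "pverts K \<noteq> {}"
    using G_nonempty H_nonempty by simp
  obtain x where x: "x \<in> pverts K" "\<gamma>'\<^sub>c\<^sub>g K = Suc (moves_left K Dominator {x})"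
    using K.staller_start_number_attained[OF ne] .
  then obtain g h where gh: "x = (g, h)" "g \<in> pverts G" "h \<in> pverts H"
    by auto
  have "closed_nbhd G g = pverts G" "closed_nbhd H h = pverts H"
    using G.connected_imp_dominated_eq[OF conn, of "{g}"] gh(2)
      G.staller_start_number_eq_1D[OF assms(1) gh(2)]
      H.connected_imp_dominated_eq[OF assms(3), of "{h}"] gh(3)
      H.staller_start_number_eq_1D[OF assms(2) gh(3)] by simp_all
  then have "dominated K {x} = pverts K"
    using gh by (auto simp: closed_nbhd_K closed_nbhd_def[of G] dest: H.in_arcsD2 G.in_arcsD2)
  then have "legal_moves K {x} = {}"
    using K.dominated_subset[of "{y}" for y] by (auto simp: legal_moves_def)
  then show ?thesis
    using x(2) moves_left_eq_0_iff[OF finite_K, of Dominator "{x}"] by simp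
qed

end

end

theorem theorem4p6:
  fixes G :: "'a pair_pre_digraph" and H :: "'b pair_pre_digraph"
  assumes "pair_graph G" and "connected (with_proj G)"
    and "pair_graph H" and "pverts H \<noteq> {}"
    and "\<gamma>'\<^sub>c\<^sub>g G = 1 \<Longrightarrow> connected (with_proj H)"
  shows "(\<gamma>'\<^sub>c\<^sub>g G \<ge> 2 \<longrightarrow>
            \<gamma>'\<^sub>c\<^sub>g (lex_product G H) = \<gamma>'\<^sub>c\<^sub>g G) \<and>
         (\<gamma>'\<^sub>c\<^sub>g G = 1 \<and> card (pverts G) \<ge> 2 \<and> \<gamma>'\<^sub>c\<^sub>g H \<ge> 2 \<longrightarrow>
            \<gamma>'\<^sub>c\<^sub>g (lex_product G H) = 2) \<and>
         (card (pverts G) = 1 \<or>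
            \<gamma>'\<^sub>c\<^sub>g G = 1 \<and> card (pverts G) \<ge> 2 \<and> \<gamma>'\<^sub>c\<^sub>g H = 1 \<longrightarrow>
            \<gamma>'\<^sub>c\<^sub>g (lex_product G H) = \<gamma>'\<^sub>c\<^sub>g H)"
proof -
  interpret lex_pair G H
    using assms(1,3) by (simp add: lex_pair_def)
  show ?thesis
  proof (cases "\<exists>g. pverts G = {g}")
    case True
    then obtain g where g: "pverts G = {g}"
      by blast
    \<comment> \<open>A single vertex gives the value 1 for \<open>G\<close>, so only the last case
      of the claim applies.\<close>
    have "legal_moves G {g} = {}"
      using legal_moves_subset[of G "{g}"] g by auto
    then have "\<gamma>'\<^sub>c\<^sub>g G = 1"
      using G.staller_start_number_attained g
      by (metis One_nat_def G.pair_finite_verts insert_not_empty moves_left_eq_0_iff singletonD)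
    then show ?thesis
      using staller_start_number_single_layer[OF g] g by simp
  next
    case False
    then have nontrivial: "\<And>g. pverts G \<noteq> {g}" and "card (pverts G) \<noteq> 1"
      by (auto simp: card_1_singleton_iff)
    \<comment> \<open>The lower bound and the upper bound by the maximum with 2 meet as soon as the
      value for \<open>G\<close> is at least 2.\<close>
    with staller_start_number_ge_left[OF assms(2) nontrivial assms(4)]
      staller_start_number_le_max[OF assms(2) nontrivial assms(4)]
      staller_start_number_complete[OF assms(2) nontrivial assms(4)]
      staller_start_number_complete_complete[OF assms(2) nontrivial assms(4)] assms(5)
    show ?thesis
      by auto
  qed
qed

end
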